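(* Let $m\ge1$ be an integer and let $\{x_j\}$ be a non-decreasing sequence of real knots (indexed by consecutive integers) with $0<x_{j+m}-x_j<\frac{2\pi h}{\ln(1+h)}$ for all $j$. Let $(x_k,x_r)$ be any nonempty interval, with $x_k,x_r$ knots, such that at least $m$ of the values $x_j$ satisfy $x_j\le x_k$ and at least $m$ of the values $x_j$ satisfy $x_j\ge x_r$. Then for $x\in(x_k,x_r)$ and $y\in\mathbb{R}$, $$\left(e_h^{iy}-e_h^{ix}\right)_h^{m-1}=\sum_j\tilde E_{j,m}(x;h)\prod_{l=1}^{m-1}\left(e_h^{iy}-e_h^{ix_{j+l}}\right).$$
   Context: Fix a real number $h\neq0$, $h>-1$. For real $x$ put $e_h^{ix}=(1+h)^{ix/h}=\exp\left(ix\frac{\ln(1+h)}{h}\right)$. $h$-power: $\left(e_h^{iy}-e_h^{ix}\right)_h^{m-1}=\prod_{l=0}^{m-2}\left(e_h^{iy}-e_h^{i(x-lh)}\right)$, equal to $1$ for $m=1$. $h$-truncated power: $\left(e_h^{iy}-e_h^{ix}\right)_+^{m-1}=\left(e_h^{iy}-e_h^{ix}\right)_h^{m-1}$ if $y>x$, and $0$ if $y\le x$. $h$-exponential divided difference: for nodes $x_0<\cdots<x_m$ with $x_m-x_0<\frac{2\pi h}{\ln(1+h)}$, $[x_k;h]_ef=f(x_k)$ and $[x_0,\ldots,x_m;h]_ef=\frac{[x_1,\ldots,x_m;h]_ef-[x_0,\ldots,x_{m-1};h]_ef}{e_h^{ix_m}-e_h^{ix_0}}$ for $m\ge1$. If some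 (not all) of the nodes coincide, the divided difference is read as the limit of its values at distinct nodes that approach the given ones from the left. For $m\ge 1$, $E_{j,m}(x;h)\equiv0$ if $x_{j+m}=x_j$, and if $x_{j+m}>x_j$, $E_{j,m}(x;h)=[x_j,\ldots,x_{j+m};h]_e\left(e_h^{iy}-e_h^{ix}\right)_+^{m-1}$ (divided difference with respect to $y$). Further, $\tilde E_{j,m}(x;h)=\left(e_h^{ix_{j+m}}-e_h^{ix_j}\right)E_{j,m}(x;h)$. The sum over $j$ runs over all indices for which $x_j,\dots,x_{j+m}$ are knots. *)

theory Defs
  imports "HOL-Analysis.Analysis"
begin

definition hexp :: "real \<Rightarrow> real \<Rightarrow> complex" where
  "hexp h x = exp (\<i> * complex_of_real (x * (ln (1 + h) / h)))"

text \<open>The argument \<open>n\<close> is the number of factors, i.e. \<open>m - 1\<close> for the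
  \<open>h\<close>-power with exponent \<open>m - 1\<close>.\<close>

definition hpower :: "real \<Rightarrow> nat \<Rightarrow> real \<Rightarrow> real \<Rightarrow> complex" where
  "hpower h n y x = (\<Prod>l<n. hexp h y - hexp h (x - real l * h))"

definition htrunc_power :: "real \<Rightarrow> nat \<Rightarrow> real \<Rightarrow> real \<Rightarrow> complex" where
  "htrunc_power h n y x = (if y > x then hpower h n y x else 0)"

text \<open>\<open>hdd_distinct h f t j n\<close> is the divided difference of \<open>f\<close> at the \<open>n + 1\<close> nodes
  \<open>t j, \<dots>, t (j + n)\<close>; it is meaningful for \<open>t j < \<dots> < t (j + n)\<close> with
  \<open>t (j + n) - t j < 2 \<pi> h / ln (1 + h)\<close>, where no denominator vanishes.\<close>

primrec hdd_distinct ::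
  "real \<Rightarrow> (real \<Rightarrow> complex) \<Rightarrow> (nat \<Rightarrow> real) \<Rightarrow> nat \<Rightarrow> nat \<Rightarrow> complex" where
  "hdd_distinct h f t j 0 = f (t j)"
| "hdd_distinct h f t j (Suc n) =
     (hdd_distinct h f t (Suc j) n - hdd_distinct h f t j n)
       / (hexp h (t (j + Suc n)) - hexp h (t j))"

text \<open>The divided difference at non-decreasing nodes \<open>t 0, \<dots>, t n\<close>. For coinciding nodes it
  is the common limit along all sequences \<open>s\<close> of strictly increasing node tuples that tend to
  the given nodes from the left.\<close>

definition hdd :: "real \<Rightarrow> (real \<Rightarrow> complex) \<Rightarrow> (nat \<Rightarrow> real) \<Rightarrow> nat \<Rightarrow> complex" where
  "hdd h f t n =
     (if strict_mono_on {..n} t then hdd_distinct h f t 0 n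
      else (THE L. \<forall>s :: nat \<Rightarrow> nat \<Rightarrow> real.
              (\<forall>p. strict_mono_on {..n} (s p)) \<and>
              (\<forall>i\<le>n. (\<forall>p. s p i < t i) \<and> (\<lambda>p. s p i) \<longlonglongrightarrow> t i) \<longrightarrow>
              (\<lambda>p. hdd_distinct h f (s p) 0 n) \<longlonglongrightarrow> L))"

definition hBspline :: "real \<Rightarrow> (int \<Rightarrow> real) \<Rightarrow> nat \<Rightarrow> int \<Rightarrow> real \<Rightarrow> complex" where
  "hBspline h X m j x =
     (if X (j + int m) = X j then 0
      else hdd h (\<lambda>y. htrunc_power h (m - 1) y x) (\<lambda>i. X (j + int i)) m)"

definition hBspline_normalized :: "real \<Rightarrow> (int \<Rightarrow> real) \<Rightarrow> nat \<Rightarrow> int \<Rightarrow> real \<Rightarrow> complex" where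
  "hBspline_normalized h X m j x =
     (hexp h (X (j + int m)) - hexp h (X j)) * hBspline h X m j x"

end

theory Submission
  imports Defs
begin

text \<open>
  Write \<open>z\<^sub>j\<close> for \<open>hexp h (x\<^sub>j)\<close>. The theorem is a telescoping sum of interpolation polynomials.

  Take distinct knots first and let \<open>f\<close> be any function of \<open>y\<close>. Let \<open>p\<^sub>j\<close> be the polynomial of
  degree less than \<open>m\<close> that takes the values of \<open>f\<close> at the \<open>m\<close> nodes \<open>z\<^sub>j, \<dots>, z\<^bsub>j+m-1\<^esub>\<close>. The polynomials
  \<open>p\<^bsub>j+1\<^esub>\<close> and \<open>p\<^sub>j\<close> agree at the \<open>m - 1\<close> common nodes, so their difference is the difference of their
  leading coefficients times \<open>\<Prod>l=1..m-1. (w - z\<^bsub>j+l\<^esub>)\<close>. Leading coefficients of interpolants are divided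
  differences, so this is the \<open>j\<close>-th summand of the theorem when \<open>f\<close> is the truncated power
  (\<open>newton_step\<close>). The sum over consecutive \<open>j\<close> therefore telescopes to the last interpolant minus
  the first. The first one interpolates at knots to the left of \<open>x\<close>, where the truncated power is
  zero, and the last one at knots to the right of \<open>x\<close>, where the truncated power coincides with the
  \<open>h\<close>-power, itself a polynomial of degree \<open>m - 1\<close> in \<open>hexp h y\<close> and hence reproduced
  (\<open>newton_hpower\<close>).

  Coincident knots are reached by moving all knots slightly to the left so that they become
  distinct. If the move is small, the sum over the moved knots is still the same \<open>h\<close>-power, and
  its summands converge to the desired ones. The convergence is the analytic part: divided
  differences of the truncated power converge, to a value that does not depend on how the
  knots are approached (\<open>hdd_distinct_htrunc_convergent\<close>). As long as the two extreme nodes have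
  different limits the recursion passes to the limit. When all nodes tend to one point, they
  finally lie on one side of \<open>x\<close>: there the truncated power is either zero or the \<open>h\<close>-power, whose
  divided differences are polynomials in the nodes by the Leibniz rule. Approach from the left
  matters only when a knot equals \<open>x\<close>, where it selects the zero branch.

  The sum may be infinite, but a summand whose knots all lie on the same side of \<open>x\<close> vanishes:
  this is the telescoping identity for a single summand.
\<close>

section \<open>The exponential separates close nodes\<close>

text \<open>Both signs of \<open>h\<close> are covered because \<open>ln (1 + h) / h\<close> is positive in either case.\<close>

lemma hexp_neq:
  assumes h: "h \<noteq> 0" "h > -1" and ab: "a < b" "b - a < 2 * pi * h / ln (1 + h)"
  shows "hexp h a \<noteq> hexp h b"
proof
  define c where "c = ln (1 + h) / h"
  have c: "c > 0"
    using h by (cases "h > 0") (auto simp: c_def zero_less_divide_iff ln_less_zero_iff)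
  have bound: "(b - a) * c < 2 * pi"
  proof -
    have "2 * pi * h / ln (1 + h) * c = 2 * pi"
      using c by (auto simp: c_def)
    thus ?thesis
      using mult_strict_right_mono[OF ab(2) c] by simp
  qed
  assume "hexp h a = hexp h b"
  then obtain n :: int where
    n: "\<i> * complex_of_real (b * c) = \<i> * complex_of_real (a * c) + of_int (2 * n) * pi * \<i>"
    unfolding hexp_def c_def by (metis exp_eq)
  have "(b - a) * c = real_of_int n * (2 * pi)"
    using arg_cong[OF n, of Im] by (simp add: algebra_simps)
  moreover have "(b - a) * c > 0"
    using ab c by simp
  ultimately have "0 < real_of_int n * (2 * pi)" "real_of_int n * (2 * pi) < 1 * (2 * pi)"
    using bound by simp_all
  hence "0 < real_of_int n" "real_of_int n < 1"
    by (auto simp: zero_less_mult_iff mult_less_cancel_right)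
  thus False
    by simp
qed

lemma inj_on_hexp_nodes:
  assumes h: "h \<noteq> 0" "h > -1"
    and t: "strict_mono_on {a..b::nat} t" "t b - t a < 2 * pi * h / ln (1 + h)"
  shows "inj_on (\<lambda>i. hexp h (t i)) {a..b}"
proof (rule linorder_inj_onI)
  fix i i' assume i: "i < i'" "i \<in> {a..b}" "i' \<in> {a..b}"
  note le = strict_mono_on_leD[OF t(1)]
  have "t a \<le> t i" "t i' \<le> t b" "t i < t i'"
    using i le[of a i] le[of i' b] strict_mono_onD[OF t(1), of i i'] by auto
  thus "hexp h (t i) \<noteq> hexp h (t i')"
    using t(2) by (intro hexp_neq h) auto
qed auto

lemma tendsto_hexp:
  "(u \<longlongrightarrow> a) F \<Longrightarrow> ((\<lambda>p. hexp h (u p)) \<longlongrightarrow> hexp h a) F"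
  unfolding hexp_def by (intro tendsto_intros)

section \<open>Divided differences at distinct nodes\<close>

lemma hdd_distinct_cong:
  "(\<And>i. i \<in> {j..j + n} \<Longrightarrow> f (t i) = g (t i)) \<Longrightarrow> hdd_distinct h f t j n = hdd_distinct h g t j n"
proof (induction n arbitrary: j)
  case (Suc n)
  have "hdd_distinct h f t (Suc j) n = hdd_distinct h g t (Suc j) n"
       "hdd_distinct h f t j n = hdd_distinct h g t j n"
    by (intro Suc.IH Suc.prems; simp)+
  thus ?case by simp
qed simp

lemma hdd_distinct_const: "hdd_distinct h (\<lambda>_. c) t j n = (if n = 0 then c else 0)"
  by (induction n arbitrary: j) simp_all

lemma hdd_distinct_shift:
  "hdd_distinct h f (\<lambda>i. t (d + i)) j n = hdd_distinct h f t (d + j) n"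
  by (induction n arbitrary: j) (simp_all add: add.assoc)

lemma hdd_distinct_step:
  assumes "inj_on (\<lambda>i. hexp h (t i)) {j..j + Suc n}"
  shows "(hexp h (t (j + Suc n)) - hexp h (t j)) * hdd_distinct h f t j (Suc n) =
           hdd_distinct h f t (Suc j) n - hdd_distinct h f t j n"
proof -
  have "hexp h (t (j + Suc n)) \<noteq> hexp h (t j)"
    using inj_onD[OF assms, of "j + Suc n" j] by auto
  thus ?thesis by simp
qed

text \<open>The Leibniz rule, for a product with a factor that is linear in \<open>hexp h y\<close>. The \<open>h\<close>-power is
  a product of such factors, so this rule drives every induction over its exponent.\<close>

lemma hdd_distinct_mult_linear:
  assumes "inj_on (\<lambda>i. hexp h (t i)) {j..j + n}"
  shows "hdd_distinct h (\<lambda>y. f y * (hexp h y - q)) t j n =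
           (hexp h (t (j + n)) - q) * hdd_distinct h f t j n +
           (if n = 0 then 0 else hdd_distinct h f t j (n - 1))"
  using assms
proof (induction n arbitrary: j)
  case (Suc n)
  let ?g = "\<lambda>y. f y * (hexp h y - q)"
  let ?D = "hdd_distinct h f t" and ?z = "\<lambda>i. hexp h (t i)"
  have inj: "inj_on ?z {Suc j..Suc j + n}" "inj_on ?z {j..j + n}"
    by (rule inj_on_subset[OF Suc.prems]; auto)+
  have lower: "(if n = 0 then 0 else ?D (Suc j) (n - 1)) - (if n = 0 then 0 else ?D j (n - 1)) =
      (?z (j + n) - ?z j) * ?D j n"
    using hdd_distinct_step[of h t j "n - 1" f] inj(2) by (cases n) simp_all
  have "hdd_distinct h ?g t (Suc j) n - hdd_distinct h ?g t j n =
      (?z (j + Suc n) - q) * ?D (Suc j) n - (?z (j + n) - q) * ?D j n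
      + ((if n = 0 then 0 else ?D (Suc j) (n - 1)) - (if n = 0 then 0 else ?D j (n - 1)))"
    using Suc.IH[OF inj(1)] Suc.IH[OF inj(2)] by simp
  also have "\<dots> = (?z (j + Suc n) - q) * (?D (Suc j) n - ?D j n) + (?z (j + Suc n) - ?z j) * ?D j n"
    unfolding lower by (simp add: algebra_simps)
  also have "\<dots> = (?z (j + Suc n) - ?z j) * ((?z (j + Suc n) - q) * ?D j (Suc n) + ?D j n)"
    unfolding hdd_distinct_step[OF Suc.prems, symmetric] by (simp only: algebra_simps)
  finally have "(?z (j + Suc n) - ?z j) * hdd_distinct h ?g t j (Suc n) =
      (?z (j + Suc n) - ?z j) * ((?z (j + Suc n) - q) * ?D j (Suc n) + ?D j n)"
    unfolding hdd_distinct_step[OF Suc.prems] .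
  moreover have "?z (j + Suc n) - ?z j \<noteq> 0"
    using inj_onD[OF Suc.prems, of "j + Suc n" j] by auto
  ultimately show ?case
    by (simp only: mult_cancel_left) simp
qed simp

lemma hpower_Suc:
  "hpower h (Suc k) y x = hpower h k y x * (hexp h y - hexp h (x - real k * h))"
  by (simp add: hpower_def)

lemma hdd_distinct_hpower_eq_0:
  assumes "k < n" "inj_on (\<lambda>i. hexp h (t i)) {j..j + n}"
  shows "hdd_distinct h (\<lambda>y. hpower h k y x) t j n = 0"
  using assms
proof (induction k arbitrary: n)
  case 0
  thus ?case
    by (simp add: hpower_def hdd_distinct_const)
next
  case (Suc k)
  have "inj_on (\<lambda>i. hexp h (t i)) {j..j + (n - 1)}"
    by (rule inj_on_subset[OF Suc.prems(2)]) auto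
  thus ?case
    using Suc by (simp add: hpower_Suc hdd_distinct_mult_linear)
qed

section \<open>Newton interpolation\<close>

text \<open>The polynomial in \<open>w\<close> that interpolates \<open>f\<close> at the \<open>m\<close> nodes \<open>hexp h (t j), \<dots>\<close>, in
  Newton form. This form gives both properties below by algebra alone, without
  any appeal to the uniqueness of interpolating polynomials.\<close>

definition newton ::
  "real \<Rightarrow> (real \<Rightarrow> complex) \<Rightarrow> (nat \<Rightarrow> real) \<Rightarrow> nat \<Rightarrow> nat \<Rightarrow> complex \<Rightarrow> complex" where
  "newton h f t m j w = (\<Sum>i<m. hdd_distinct h f t j i * (\<Prod>l<i. w - hexp h (t (j + l))))"

lemma newton_cong:
  assumes "\<And>i. i \<in> {j..<j + m} \<Longrightarrow> f (t i) = g (t i)"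
  shows "newton h f t m j w = newton h g t m j w"
proof -
  have "hdd_distinct h f t j i = hdd_distinct h g t j i" if "i < m" for i
    using that by (intro hdd_distinct_cong assms) auto
  thus ?thesis
    unfolding newton_def by (intro sum.cong) auto
qed

text \<open>Neighbouring interpolants share \<open>n\<close> nodes, so their difference vanishes there and is
  determined by its leading coefficient.\<close>

lemma newton_step:
  assumes "inj_on (\<lambda>i. hexp h (t i)) {j..j + n}"
  shows "newton h f t (Suc n) (Suc j) w - newton h f t (Suc n) j w =
           (hdd_distinct h f t (Suc j) n - hdd_distinct h f t j n) *
           (\<Prod>l = 1..n. w - hexp h (t (j + l)))"
  using assms
proof (induction n)
  case (Suc n)
  let ?D = "hdd_distinct h f t" and ?z = "\<lambda>i. hexp h (t i)"
  let ?P = "\<Prod>l = 1..n. w - ?z (j + l)"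
  have inj: "inj_on ?z {j..j + n}"
    by (rule inj_on_subset[OF Suc.prems]) auto
  have first: "(\<Prod>l<Suc n. w - ?z (j + l)) = (w - ?z j) * ?P"
    by (subst prod.lessThan_Suc_shift) (simp add: prod.shift_bounds_Suc_ivl
        prod.atLeast1_atMost_eq)
  have last: "(\<Prod>l<Suc n. w - ?z (Suc j + l)) = (\<Prod>l = 1..Suc n. w - ?z (j + l))"
    by (simp add: prod.atLeast1_atMost_eq)
  have last': "(\<Prod>l = 1..Suc n. w - ?z (j + l)) = ?P * (w - ?z (j + Suc n))"
    by simp
  have split: "newton h f t (Suc (Suc n)) i w =
      newton h f t (Suc n) i w + ?D i (Suc n) * (\<Prod>l<Suc n. w - ?z (i + l))" for i
    by (simp only: newton_def sum.lessThan_Suc)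
  have "newton h f t (Suc (Suc n)) (Suc j) w - newton h f t (Suc (Suc n)) j w =
      (newton h f t (Suc n) (Suc j) w - newton h f t (Suc n) j w)
      + ?D (Suc j) (Suc n) * (\<Prod>l<Suc n. w - ?z (Suc j + l))
      - ?D j (Suc n) * (\<Prod>l<Suc n. w - ?z (j + l))"
    unfolding split by (simp only: algebra_simps)
  also have "\<dots> = (?z (j + Suc n) - ?z j) * ?D j (Suc n) * ?P
      + ?D (Suc j) (Suc n) * (?P * (w - ?z (j + Suc n)))
      - ?D j (Suc n) * ((w - ?z j) * ?P)"
    unfolding Suc.IH[OF inj] hdd_distinct_step[OF Suc.prems] first last last' ..
  also have "\<dots> = (?D (Suc j) (Suc n) - ?D j (Suc n)) * (?P * (w - ?z (j + Suc n)))"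
    by (simp only: algebra_simps)
  finally show ?case
    unfolding last' .
qed (simp add: newton_def)

text \<open>By the Leibniz rule an additional linear factor of the function merely multiplies the
  interpolant, provided that the leading coefficient of the latter is zero. This is the case for the
  \<open>h\<close>-power as long as its degree \<open>k\<close> in \<open>hexp h y\<close> is below \<open>n\<close>.\<close>

lemma newton_hpower:
  assumes "k \<le> n" "inj_on (\<lambda>i. hexp h (t i)) {j..j + n}"
  shows "newton h (\<lambda>y. hpower h k y x) t (Suc n) j (hexp h v) = hpower h k v x"
  using assms(1)
proof (induction k)
  case 0
  have "hdd_distinct h (\<lambda>y. hpower h 0 y x) t j i = 0" if "i \<in> {..<Suc n} - {0}" for i
  proof (rule hdd_distinct_hpower_eq_0)
    show "inj_on (\<lambda>i. hexp h (t i)) {j..j + i}"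
      by (rule inj_on_subset[OF assms(2)]) (use that in auto)
  qed (use that in auto)
  hence "newton h (\<lambda>y. hpower h 0 y x) t (Suc n) j (hexp h v) =
      (\<Sum>i\<in>{0}. hdd_distinct h (\<lambda>y. hpower h 0 y x) t j i *
        (\<Prod>l<i. hexp h v - hexp h (t (j + l))))"
    unfolding newton_def by (intro sum.mono_neutral_right) auto
  thus ?case by (simp add: hpower_def)
next
  case (Suc k)
  define q where "q = hexp h (x - real k * h)"
  define D where "D = hdd_distinct h (\<lambda>y. hpower h k y x) t j"
  define W where "W i = (\<Prod>l<i. hexp h v - hexp h (t (j + l)))" for i
  let ?z = "\<lambda>i. hexp h (t (j + i))"
  have leibniz: "hdd_distinct h (\<lambda>y. hpower h (Suc k) y x) t j i =
      (?z i - q) * D i + (if i = 0 then 0 else D (i - 1))" if "i \<le> n" for i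
    unfolding hpower_Suc D_def q_def
    by (rule hdd_distinct_mult_linear, rule inj_on_subset[OF assms(2)]) (use that in auto)
  have Dn: "D n = 0"
    using Suc.prems assms(2) unfolding D_def by (intro hdd_distinct_hpower_eq_0) auto
  have "newton h (\<lambda>y. hpower h (Suc k) y x) t (Suc n) j (hexp h v) =
      (\<Sum>i<Suc n. ((?z i - q) * D i + (if i = 0 then 0 else D (i - 1))) * W i)"
    unfolding newton_def W_def by (intro sum.cong refl) (simp add: leibniz)
  also have "\<dots> = (\<Sum>i<Suc n. (?z i - q) * D i * W i)
      + (\<Sum>i<Suc n. (if i = 0 then 0 else D (i - 1)) * W i)"
    by (simp only: distrib_right sum.distrib)
  also have "(\<Sum>i<Suc n. (if i = 0 then 0 else D (i - 1)) * W i) = (\<Sum>i<n. D i * W (Suc i))"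
    by (subst sum.lessThan_Suc_shift) simp
  also have "\<dots> = (\<Sum>i<Suc n. (hexp h v - ?z i) * D i * W i)"
    by (simp add: Dn W_def mult_ac)
  also have "(\<Sum>i<Suc n. (?z i - q) * D i * W i) + (\<Sum>i<Suc n. (hexp h v - ?z i) * D i * W i) =
      (hexp h v - q) * (\<Sum>i<Suc n. D i * W i)"
    unfolding sum_distrib_left sum.distrib[symmetric]
    by (intro sum.cong refl) (simp add: algebra_simps)
  also have "(\<Sum>i<Suc n. D i * W i) = hpower h k v x"
    using Suc unfolding newton_def D_def W_def by simp
  finally show ?case
    by (simp add: hpower_Suc q_def mult.commute)
qed

lemma sum_telescope_newton:
  assumes "\<And>j. j < N \<Longrightarrow> inj_on (\<lambda>i. hexp h (t i)) {j..j + Suc n}"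
  shows "(\<Sum>j<N. (hexp h (t (j + Suc n)) - hexp h (t j)) * hdd_distinct h f t j (Suc n) *
            (\<Prod>l = 1..n. w - hexp h (t (j + l)))) =
         newton h f t (Suc n) N w - newton h f t (Suc n) 0 w"
proof -
  have "(hexp h (t (j + Suc n)) - hexp h (t j)) * hdd_distinct h f t j (Suc n) *
          (\<Prod>l = 1..n. w - hexp h (t (j + l))) =
        newton h f t (Suc n) (Suc j) w - newton h f t (Suc n) j w" if "j < N" for j
  proof -
    have "inj_on (\<lambda>i. hexp h (t i)) {j..j + n}"
      by (rule inj_on_subset[OF assms[OF that]]) auto
    thus ?thesis
      unfolding hdd_distinct_step[OF assms[OF that]] by (simp only: newton_step)
  qed
  hence "(\<Sum>j<N. (hexp h (t (j + Suc n)) - hexp h (t j)) * hdd_distinct h f t j (Suc n) *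
            (\<Prod>l = 1..n. w - hexp h (t (j + l)))) =
         (\<Sum>j<N. newton h f t (Suc n) (Suc j) w - newton h f t (Suc n) j w)"
    by (intro sum.cong) auto
  thus ?thesis
    by (simp only: sum_lessThan_telescope[of "\<lambda>j. newton h f t (Suc n) j w"])
qed

section \<open>Divided differences at coincident nodes\<close>

text \<open>The limit is chosen before the sequence \<open>s\<close>: it depends on the limits of the nodes only, because
  the Leibniz rule expresses the divided difference of an \<open>h\<close>-power as a polynomial in the
  exponentials of the nodes.\<close>

lemma hdd_distinct_hpower_convergent:
  "\<exists>L. \<forall>s. (\<forall>i\<in>{j..j + n}. (\<lambda>p. s p i) \<longlonglongrightarrow> t i) \<longrightarrow>
      (\<forall>\<^sub>F p in sequentially. inj_on (\<lambda>i. hexp h (s p i)) {j..j + n}) \<longrightarrow>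
      (\<lambda>p::nat. hdd_distinct h (\<lambda>y. hpower h k y x) (s p) j n) \<longlonglongrightarrow> L"
proof (induction k arbitrary: n)
  case 0
  show ?case
  proof (intro exI allI impI)
    fix s :: "nat \<Rightarrow> nat \<Rightarrow> real"
    assume "\<forall>\<^sub>F p in sequentially. inj_on (\<lambda>i. hexp h (s p i)) {j..j + n}"
    hence "\<forall>\<^sub>F p in sequentially. hdd_distinct h (\<lambda>y. hpower h 0 y x) (s p) j n =
        (if n = 0 then 1 else 0)"
      by eventually_elim (simp add: hpower_def hdd_distinct_const)
    thus "(\<lambda>p. hdd_distinct h (\<lambda>y. hpower h 0 y x) (s p) j n) \<longlonglongrightarrow> (if n = 0 then 1 else 0)"
      by (rule tendsto_eventually)
  qed
next
  case (Suc k)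
  let ?D = "\<lambda>n s p. hdd_distinct h (\<lambda>y. hpower h k y x) (s (p::nat)) j n"
  obtain L where L: "\<And>n s. (\<forall>i\<in>{j..j + n}. (\<lambda>p. s p i) \<longlonglongrightarrow> t i) \<Longrightarrow>
      (\<forall>\<^sub>F p in sequentially. inj_on (\<lambda>i. hexp h (s p i)) {j..j + n}) \<Longrightarrow> ?D n s \<longlonglongrightarrow> L n"
    using Suc.IH by metis
  show ?case
  proof (intro exI allI impI)
    fix s :: "nat \<Rightarrow> nat \<Rightarrow> real"
    let ?q = "hexp h (x - real k * h)"
    assume s: "\<forall>i\<in>{j..j + n}. (\<lambda>p. s p i) \<longlonglongrightarrow> t i"
      and inj: "\<forall>\<^sub>F p in sequentially. inj_on (\<lambda>i. hexp h (s p i)) {j..j + n}"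
    have inj': "\<forall>\<^sub>F p in sequentially. inj_on (\<lambda>i. hexp h (s p i)) {j..j + (n - 1)}"
      using inj by eventually_elim (erule inj_on_subset, auto)
    have "?D n s \<longlonglongrightarrow> L n"
      using s inj by (rule L)
    moreover have "?D (n - 1) s \<longlonglongrightarrow> L (n - 1)"
      using s by (intro L inj') auto
    moreover have "(\<lambda>p. hexp h (s p (j + n))) \<longlonglongrightarrow> hexp h (t (j + n))"
      using s by (intro tendsto_hexp) auto
    ultimately have "(\<lambda>p. (hexp h (s p (j + n)) - ?q) * ?D n s p + (if n = 0 then 0 else ?D (n - 1) s p))
        \<longlonglongrightarrow> (hexp h (t (j + n)) - ?q) * L n + (if n = 0 then 0 else L (n - 1))"
      by (cases "n = 0") (auto intro!: tendsto_intros)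
    moreover have "\<forall>\<^sub>F p in sequentially.
        (hexp h (s p (j + n)) - ?q) * ?D n s p + (if n = 0 then 0 else ?D (n - 1) s p) =
        hdd_distinct h (\<lambda>y. hpower h (Suc k) y x) (s p) j n"
      using inj by eventually_elim (simp only: hpower_Suc hdd_distinct_mult_linear)
    ultimately show "(\<lambda>p. hdd_distinct h (\<lambda>y. hpower h (Suc k) y x) (s p) j n)
        \<longlonglongrightarrow> (hexp h (t (j + n)) - ?q) * L n + (if n = 0 then 0 else L (n - 1))"
      by (rule Lim_transform_eventually)
  qed
qed

text \<open>When all nodes approach one point, the recursion for divided differences degenerates to a
  quotient whose denominator tends to zero. But then all nodes are finally on one side of \<open>x\<close>,
  where the truncated power has a single branch.\<close>

lemma hdd_distinct_htrunc_convergent_coincident: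
  assumes h: "h \<noteq> 0" "h > -1" and t: "\<And>i. i \<in> {j..j + n} \<Longrightarrow> t i = c"
  shows "\<exists>L. \<forall>s. (\<forall>p. strict_mono_on {j..j + n} (s p)) \<longrightarrow>
      (\<forall>i\<in>{j..j + n}. (\<forall>p. s p i \<le> t i) \<and> (\<lambda>p. s p i) \<longlonglongrightarrow> t i) \<longrightarrow>
      (\<lambda>p::nat. hdd_distinct h (\<lambda>y. htrunc_power h k y x) (s p) j n) \<longlonglongrightarrow> L"
proof (cases "c \<le> x")
  case True
  have "hdd_distinct h (\<lambda>y. htrunc_power h k y x) (s p) j n = 0"
    if "\<forall>i\<in>{j..j + n}. (\<forall>p. s p i \<le> t i) \<and> (\<lambda>p. s p i) \<longlonglongrightarrow> t i" for s and p :: nat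
  proof -
    have "hdd_distinct h (\<lambda>y. htrunc_power h k y x) (s p) j n = hdd_distinct h (\<lambda>_. 0) (s p) j n"
    proof (rule hdd_distinct_cong)
      fix i assume i: "i \<in> {j..j + n}"
      have "s p i \<le> t i"
        using that i by blast
      hence "s p i \<le> x"
        using t[OF i] True by simp
      thus "htrunc_power h k (s p i) x = 0"
        by (simp add: htrunc_power_def)
    qed
    thus ?thesis
      by (simp add: hdd_distinct_const)
  qed
  thus ?thesis
    by (intro exI[of _ 0]) simp
next
  case False
  obtain L where L: "\<And>s. (\<forall>i\<in>{j..j + n}. (\<lambda>p. s p i) \<longlonglongrightarrow> t i) \<Longrightarrow>
      (\<forall>\<^sub>F p in sequentially. inj_on (\<lambda>i. hexp h (s p i)) {j..j + n}) \<Longrightarrow>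
      (\<lambda>p::nat. hdd_distinct h (\<lambda>y. hpower h k y x) (s p) j n) \<longlonglongrightarrow> L"
    using hdd_distinct_hpower_convergent[of j n t h k x] by blast
  show ?thesis
  proof (intro exI allI impI)
    fix s :: "nat \<Rightarrow> nat \<Rightarrow> real"
    assume mono: "\<forall>p. strict_mono_on {j..j + n} (s p)"
      and s: "\<forall>i\<in>{j..j + n}. (\<forall>p. s p i \<le> t i) \<and> (\<lambda>p. s p i) \<longlonglongrightarrow> t i"
    have "(\<lambda>p. s p (j + n) - s p j) \<longlonglongrightarrow> t (j + n) - t j"
      using s by (intro tendsto_intros) auto
    moreover have "t (j + n) - t j < 2 * pi * h / ln (1 + h)"
    proof -
      have "0 < 2 * pi * h / ln (1 + h)"
        using h by (cases "h > 0") (auto simp: zero_less_divide_iff ln_less_zero_iff mult_less_0_iff)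
      thus ?thesis
        by (simp add: t)
    qed
    ultimately have "\<forall>\<^sub>F p in sequentially. s p (j + n) - s p j < 2 * pi * h / ln (1 + h)"
      by (rule order_tendstoD)
    hence "\<forall>\<^sub>F p in sequentially. inj_on (\<lambda>i. hexp h (s p i)) {j..j + n}"
      by eventually_elim (intro inj_on_hexp_nodes h mono[rule_format])
    hence lim: "(\<lambda>p. hdd_distinct h (\<lambda>y. hpower h k y x) (s p) j n) \<longlonglongrightarrow> L"
      using s by (intro L) auto
    have "\<forall>\<^sub>F p in sequentially. \<forall>i\<in>{j..j + n}. x < s p i"
    proof (intro eventually_ball_finite ballI)
      fix i assume i: "i \<in> {j..j + n}"
      have "(\<lambda>p. s p i) \<longlonglongrightarrow> t i"
        using s i by blast
      moreover have "x < t i"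
        using t[OF i] False by simp
      ultimately show "\<forall>\<^sub>F p in sequentially. x < s p i"
        by (rule order_tendstoD)
    qed auto
    hence "\<forall>\<^sub>F p in sequentially. hdd_distinct h (\<lambda>y. hpower h k y x) (s p) j n =
        hdd_distinct h (\<lambda>y. htrunc_power h k y x) (s p) j n"
      by eventually_elim (auto intro!: hdd_distinct_cong simp: htrunc_power_def)
    with lim show "(\<lambda>p. hdd_distinct h (\<lambda>y. htrunc_power h k y x) (s p) j n) \<longlonglongrightarrow> L"
      by (rule Lim_transform_eventually)
  qed
qed

text \<open>Nodes with \<open>s p i \<le> t i\<close> are admitted, and not only those with \<open>s p i < t i\<close>. When the
  nodes \<open>t i\<close> are distinct, this lets a constant sequence identify the limit.\<close>

lemma hdd_distinct_htrunc_convergent: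
  assumes h: "h \<noteq> 0" "h > -1"
    and t: "mono_on {j..j + n} t" "t (j + n) - t j < 2 * pi * h / ln (1 + h)"
  shows "\<exists>L. \<forall>s. (\<forall>p. strict_mono_on {j..j + n} (s p)) \<longrightarrow>
      (\<forall>i\<in>{j..j + n}. (\<forall>p. s p i \<le> t i) \<and> (\<lambda>p. s p i) \<longlonglongrightarrow> t i) \<longrightarrow>
      (\<lambda>p::nat. hdd_distinct h (\<lambda>y. htrunc_power h k y x) (s p) j n) \<longlonglongrightarrow> L"
  using t
proof (induction n arbitrary: j)
  case (0 j)
  show ?case
    by (rule hdd_distinct_htrunc_convergent_coincident[OF h, where c = "t j"]) auto
next
  case (Suc n j)
  note mono = mono_onD[OF Suc.prems(1)]
  have "t j \<le> t (j + Suc n)"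
    by (intro mono) auto
  then consider "t j = t (j + Suc n)" | "t j < t (j + Suc n)"
    by linarith
  thus ?case
  proof cases
    case 1
    have "t i = t j" if "i \<in> {j..j + Suc n}" for i
      using that mono[of j i] mono[of i "j + Suc n"] 1 by auto
    thus ?thesis
      by (rule hdd_distinct_htrunc_convergent_coincident[OF h])
  next
    case 2
    let ?f = "\<lambda>y. htrunc_power h k y x"
    have le: "t j \<le> t (Suc j)" "t (j + n) \<le> t (j + Suc n)"
      by (intro mono; simp)+
    have "mono_on {Suc j..Suc j + n} t" "mono_on {j..j + n} t"
      by (rule mono_on_subset[OF Suc.prems(1)]; auto)+
    moreover have "t (Suc j + n) - t (Suc j) < 2 * pi * h / ln (1 + h)"
      "t (j + n) - t j < 2 * pi * h / ln (1 + h)"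
      using le Suc.prems(2) by auto
    ultimately obtain L1 L2 where
      L1: "\<And>s. (\<forall>p. strict_mono_on {Suc j..Suc j + n} (s p)) \<Longrightarrow>
        (\<forall>i\<in>{Suc j..Suc j + n}. (\<forall>p. s p i \<le> t i) \<and> (\<lambda>p. s p i) \<longlonglongrightarrow> t i) \<Longrightarrow>
        (\<lambda>p::nat. hdd_distinct h ?f (s p) (Suc j) n) \<longlonglongrightarrow> L1" and
      L2: "\<And>s. (\<forall>p. strict_mono_on {j..j + n} (s p)) \<Longrightarrow>
        (\<forall>i\<in>{j..j + n}. (\<forall>p. s p i \<le> t i) \<and> (\<lambda>p. s p i) \<longlonglongrightarrow> t i) \<Longrightarrow>
        (\<lambda>p::nat. hdd_distinct h ?f (s p) j n) \<longlonglongrightarrow> L2"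
      using Suc.IH[of "Suc j"] Suc.IH[of j] by metis
    show ?thesis
    proof (intro exI allI impI)
      fix s :: "nat \<Rightarrow> nat \<Rightarrow> real"
      assume smono: "\<forall>p. strict_mono_on {j..j + Suc n} (s p)"
        and s: "\<forall>i\<in>{j..j + Suc n}. (\<forall>p. s p i \<le> t i) \<and> (\<lambda>p. s p i) \<longlonglongrightarrow> t i"
      have sub: "strict_mono_on {Suc j..Suc j + n} (s p)" "strict_mono_on {j..j + n} (s p)" for p
        by (rule monotone_on_subset[OF smono[rule_format]]; auto)+
      have "(\<lambda>p. hdd_distinct h ?f (s p) (Suc j) n) \<longlonglongrightarrow> L1"
        using s by (intro L1) (auto simp: sub[simplified])
      moreover have "(\<lambda>p. hdd_distinct h ?f (s p) j n) \<longlonglongrightarrow> L2"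
        using s by (intro L2) (auto simp: sub)
      moreover have "(\<lambda>p. hexp h (s p (j + Suc n))) \<longlonglongrightarrow> hexp h (t (j + Suc n))"
        "(\<lambda>p. hexp h (s p j)) \<longlonglongrightarrow> hexp h (t j)"
        using s by (intro tendsto_hexp; simp)+
      moreover have "hexp h (t j) \<noteq> hexp h (t (j + Suc n))"
        using 2 Suc.prems(2) by (intro hexp_neq h)
      ultimately show "(\<lambda>p. hdd_distinct h ?f (s p) j (Suc n)) \<longlonglongrightarrow>
          (L1 - L2) / (hexp h (t (j + Suc n)) - hexp h (t j))"
        unfolding hdd_distinct.simps by (intro tendsto_intros) auto
    qed
  qed
qed

text \<open>The given sequence \<open>s\<close> also shows that the definite description in \<open>hdd\<close> is well-defined: without
  any admissible sequence every number would satisfy it.\<close>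

lemma tendsto_hdd_htrunc:
  assumes h: "h \<noteq> 0" "h > -1"
    and t: "mono_on {..n} t" "t n - t 0 < 2 * pi * h / ln (1 + h)"
    and s: "\<And>p. strict_mono_on {..n} (s p)" "\<And>p i. i \<le> n \<Longrightarrow> s p i < t i"
      "\<And>i. i \<le> n \<Longrightarrow> (\<lambda>p. s p i) \<longlonglongrightarrow> t i"
  shows "(\<lambda>p::nat. hdd_distinct h (\<lambda>y. htrunc_power h k y x) (s p) 0 n) \<longlonglongrightarrow>
           hdd h (\<lambda>y. htrunc_power h k y x) t n"
proof -
  let ?f = "\<lambda>y. htrunc_power h k y x"
  have "mono_on {0..0 + n} t" "t (0 + n) - t 0 < 2 * pi * h / ln (1 + h)"
    using t by (simp_all add: atLeast0AtMost)
  from hdd_distinct_htrunc_convergent[OF h this, of k x] obtain L where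
    L: "\<And>u. (\<And>p. strict_mono_on {..n} (u p)) \<Longrightarrow> (\<And>p i. i \<le> n \<Longrightarrow> u p i \<le> t i) \<Longrightarrow>
      (\<And>i. i \<le> n \<Longrightarrow> (\<lambda>p. u p i) \<longlonglongrightarrow> t i) \<Longrightarrow>
      (\<lambda>p::nat. hdd_distinct h ?f (u p) 0 n) \<longlonglongrightarrow> L"
    unfolding add_0 atLeast0AtMost atMost_iff Ball_def by metis
  have lim: "(\<lambda>p. hdd_distinct h ?f (s p) 0 n) \<longlonglongrightarrow> L"
    using s by (intro L) (auto intro: less_imp_le)
  have "hdd h ?f t n = L"
  proof (cases "strict_mono_on {..n} t")
    case True
    have "(\<lambda>p::nat. hdd_distinct h ?f t 0 n) \<longlonglongrightarrow> L"
      using L[of "\<lambda>p. t"] True by auto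
    hence "hdd_distinct h ?f t 0 n = L"
      by (simp add: LIMSEQ_const_iff)
    thus ?thesis
      using True by (simp add: hdd_def)
  next
    case False
    show ?thesis
      unfolding hdd_def if_not_P[OF False]
    proof (rule the_equality)
      show "\<forall>s. (\<forall>p. strict_mono_on {..n} (s p)) \<and>
          (\<forall>i\<le>n. (\<forall>p. s p i < t i) \<and> (\<lambda>p. s p i) \<longlonglongrightarrow> t i) \<longrightarrow>
          (\<lambda>p. hdd_distinct h ?f (s p) 0 n) \<longlonglongrightarrow> L"
        by (intro allI impI L) (auto intro: less_imp_le)
    next
      fix L'
      assume "\<forall>s. (\<forall>p. strict_mono_on {..n} (s p)) \<and>
          (\<forall>i\<le>n. (\<forall>p. s p i < t i) \<and> (\<lambda>p. s p i) \<longlonglongrightarrow> t i) \<longrightarrow>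
          (\<lambda>p. hdd_distinct h ?f (s p) 0 n) \<longlonglongrightarrow> L'"
      hence "(\<lambda>p. hdd_distinct h ?f (s p) 0 n) \<longlonglongrightarrow> L'"
        using s by blast
      thus "L' = L"
        using lim by (rule LIMSEQ_unique)
    qed
  qed
  thus ?thesis
    using lim by simp
qed

section \<open>The telescoping identity for coincident knots\<close>

text \<open>Each of the two extreme interpolants has all its nodes on one side of \<open>x\<close>, so it is either
  zero or the \<open>h\<close>-power. Besides the whole sum, this covers a single summand whose knots all lie on
  one side of \<open>x\<close>: there both extreme interpolants are equal.\<close>

lemma sum_hdd_htrunc:
  assumes h: "h \<noteq> 0" "h > -1"
    and mono: "mono_on {..<N + Suc n} t"
    and gaps: "\<And>j. j < N \<Longrightarrow> t (j + Suc n) - t j < 2 * pi * h / ln (1 + h)"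
    and ends: "\<And>j. j \<in> {0, N} \<Longrightarrow> t (j + n) \<le> x \<or> x < t j"
  shows "(\<Sum>j<N. (hexp h (t (j + Suc n)) - hexp h (t j)) *
            hdd h (\<lambda>y. htrunc_power h n y x) (\<lambda>i. t (j + i)) (Suc n) *
            (\<Prod>l = 1..n. hexp h y - hexp h (t (j + l)))) =
         (if x < t N then hpower h n y x else 0) - (if x < t 0 then hpower h n y x else 0)"
    (is "?S = ?W N - ?W 0")
proof (cases "N = 0")
  case False
  let ?f = "\<lambda>y. htrunc_power h n y x"
  \<comment> \<open>The numerators decrease with \<open>i\<close> so that coinciding knots become strictly increasing,
    and they stay positive so that every knot moves to the left.\<close>
  define s where "s p i = t i - (real (N + Suc n) - real i) / real (Suc p)" for p i
  have s_less: "s p i < t i" if "i < N + Suc n" for p i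
    using that by (auto simp: s_def intro!: divide_pos_pos)
  have s_lim: "(\<lambda>p. s p i) \<longlonglongrightarrow> t i" for i
  proof -
    have "(\<lambda>p. t i - (real (N + Suc n) - real i) * inverse (real (Suc p))) \<longlonglongrightarrow>
        t i - (real (N + Suc n) - real i) * 0"
      by (intro tendsto_intros LIMSEQ_inverse_real_of_nat)
    thus ?thesis
      by (simp add: s_def divide_inverse)
  qed
  have s_mono: "strict_mono_on {..<N + Suc n} (s p)" for p
  proof (rule strict_mono_onI)
    fix i i' assume i: "i \<in> {..<N + Suc n}" "i' \<in> {..<N + Suc n}" "i < i'"
    have "t i \<le> t i'"
      using i by (intro mono_onD[OF mono]) auto
    moreover have "(real (N + Suc n) - real i') / real (Suc p) <
        (real (N + Suc n) - real i) / real (Suc p)"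
      using i by (intro divide_strict_right_mono) auto
    ultimately show "s p i < s p i'"
      unfolding s_def by linarith
  qed
  let ?T = "\<lambda>t j d. (hexp h (t (j + Suc n)) - hexp h (t j)) * d *
      (\<Prod>l = 1..n. hexp h y - hexp h (t (j + l)))"
  have lim: "(\<lambda>p. \<Sum>j<N. ?T (s p) j (hdd_distinct h ?f (s p) j (Suc n))) \<longlonglongrightarrow> ?S"
  proof (intro tendsto_intros tendsto_hexp s_lim)
    fix j assume j: "j \<in> {..<N}"
    have "(\<lambda>p. hdd_distinct h ?f (\<lambda>i. s p (j + i)) 0 (Suc n)) \<longlonglongrightarrow>
        hdd h ?f (\<lambda>i. t (j + i)) (Suc n)"
    proof (rule tendsto_hdd_htrunc[OF h])
      show "mono_on {..Suc n} (\<lambda>i. t (j + i))"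
        using j by (intro mono_onI mono_onD[OF mono]) auto
      show "strict_mono_on {..Suc n} (\<lambda>i. s p (j + i))" for p
        using j by (intro strict_mono_onI strict_mono_onD[OF s_mono]) auto
    qed (use j gaps s_less s_lim in auto)
    thus "(\<lambda>p. hdd_distinct h ?f (s p) j (Suc n)) \<longlonglongrightarrow> hdd h ?f (\<lambda>i. t (j + i)) (Suc n)"
      unfolding hdd_distinct_shift by simp
  qed
  have "\<forall>\<^sub>F p in sequentially. \<forall>j\<in>{..<N}. s p (j + Suc n) - s p j < 2 * pi * h / ln (1 + h)"
    using gaps by (intro eventually_ball_finite ballI
        order_tendstoD(2)[OF tendsto_diff[OF s_lim s_lim]]) auto
  moreover have "\<forall>\<^sub>F p in sequentially. \<forall>i\<in>{i. i < N + Suc n \<and> x < t i}. x < s p i"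
    by (intro eventually_ball_finite ballI order_tendstoD[OF s_lim]) auto
  ultimately have "\<forall>\<^sub>F p in sequentially.
      (\<Sum>j<N. ?T (s p) j (hdd_distinct h ?f (s p) j (Suc n))) = ?W N - ?W 0"
  proof eventually_elim
    case (elim p)
    have inj: "inj_on (\<lambda>i. hexp h (s p i)) {j..j + Suc n}" if "j < N" for j
    proof (rule inj_on_hexp_nodes[OF h])
      show "strict_mono_on {j..j + Suc n} (s p)"
        by (rule monotone_on_subset[OF s_mono]) (use that in auto)
    qed (use that elim in auto)
    have ends': "newton h ?f (s p) (Suc n) j (hexp h y) = ?W j" if j: "j \<in> {0, N}" for j
    proof (cases "x < t j")
      case True
      have "inj_on (\<lambda>i. hexp h (s p i)) {j..j + n}"
      proof (cases "j = 0")
        case True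
        show ?thesis
          by (rule inj_on_subset[OF inj[of 0]]) (use True \<open>N \<noteq> 0\<close> in auto)
      next
        case False
        show ?thesis
          by (rule inj_on_subset[OF inj[of "N - 1"]]) (use False j in auto)
      qed
      hence "newton h (\<lambda>y. hpower h n y x) (s p) (Suc n) j (hexp h y) = hpower h n y x"
        by (intro newton_hpower) auto
      moreover have "newton h ?f (s p) (Suc n) j (hexp h y) =
          newton h (\<lambda>y. hpower h n y x) (s p) (Suc n) j (hexp h y)"
      proof (rule newton_cong)
        fix i assume i: "i \<in> {j..<j + Suc n}"
        have "t j \<le> t i"
          using i j by (intro mono_onD[OF mono]) auto
        hence "x < s p i"
          using elim(2) True i j by auto
        thus "htrunc_power h n (s p i) x = hpower h n (s p i) x"
          by (simp add: htrunc_power_def)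
      qed
      ultimately show ?thesis
        using True by simp
    next
      case False
      have "newton h ?f (s p) (Suc n) j (hexp h y) = newton h (\<lambda>_. 0) (s p) (Suc n) j (hexp h y)"
      proof (rule newton_cong)
        fix i assume i: "i \<in> {j..<j + Suc n}"
        have "t i \<le> t (j + n)"
          using i j by (intro mono_onD[OF mono]) auto
        also have "\<dots> \<le> x"
          using ends[OF j] False by auto
        finally have "s p i \<le> x"
          using s_less[of i p] i j by auto
        thus "htrunc_power h n (s p i) x = 0"
          by (simp add: htrunc_power_def)
      qed
      thus ?thesis
        using False by (simp add: newton_def hdd_distinct_const)
    qed
    have "(\<Sum>j<N. ?T (s p) j (hdd_distinct h ?f (s p) j (Suc n))) =
        newton h ?f (s p) (Suc n) N (hexp h y) - newton h ?f (s p) (Suc n) 0 (hexp h y)"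
      by (rule sum_telescope_newton) (rule inj)
    thus ?case
      by (simp only: ends' insertI1 insertI2)
  qed
  hence "(\<lambda>p. \<Sum>j<N. ?T (s p) j (hdd_distinct h ?f (s p) j (Suc n))) \<longlonglongrightarrow> ?W N - ?W 0"
    by (rule tendsto_eventually)
  with lim show ?thesis
    by (rule LIMSEQ_unique)
qed simp

section \<open>The sum over all B-splines\<close>

text \<open>The \<open>m\<close> knots demanded on either side can be taken consecutive, because the set of
  knots up to \<open>X k\<close> (or from \<open>X r\<close> on) is an interval of indices.\<close>

lemma card_eq_imp_Min_add_le_Max:
  fixes S :: "int set"
  assumes "finite S" "card S = Suc n"
  shows "Min S + int n \<le> Max S"
proof -
  have "S \<subseteq> {Min S..Max S}"
    using assms by auto
  hence "card S \<le> card {Min S..Max S}"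
    by (intro card_mono) auto
  thus ?thesis
    using assms by simp
qed

theorem theorem5p7:
  fixes h :: real and m :: nat and I :: "int set" and X :: "int \<Rightarrow> real"
    and k r :: int and x y :: real
  assumes h: "h \<noteq> 0" "h > -1"
    and m: "m \<ge> 1"
    and consecutive: "\<And>a b. a \<in> I \<Longrightarrow> b \<in> I \<Longrightarrow> {a..b} \<subseteq> I"
    and nondecreasing: "mono_on I X"
    and gaps: "\<And>j. j \<in> I \<Longrightarrow> j + int m \<in> I \<Longrightarrow>
        0 < X (j + int m) - X j \<and> X (j + int m) - X j < 2 * pi * h / ln (1 + h)"
    and knots: "k \<in> I" "r \<in> I"
    and left: "\<exists>S \<subseteq> {j \<in> I. X j \<le> X k}. finite S \<and> card S = m"
    and right: "\<exists>S \<subseteq> {j \<in> I. X j \<ge> X r}. finite S \<and> card S = m"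
    and x: "x \<in> {X k <..< X r}"
  shows "((\<lambda>j. hBspline_normalized h X m j x *
              (\<Prod>l = 1..m - 1. hexp h y - hexp h (X (j + int l))))
          has_sum hpower h (m - 1) y x) {j. j \<in> I \<and> j + int m \<in> I}"
proof -
  obtain n where mn: "m = Suc n"
    using m by (cases m) auto
  have mono: "X i \<le> X j" if "i \<in> I" "j \<in> I" "i \<le> j" for i j
    using that by (rule mono_onD[OF nondecreasing])
  have between: "i \<in> I" if "a \<in> I" "b \<in> I" "a \<le> i" "i \<le> b" for a b i
    using consecutive[OF that(1,2)] that(3,4) by auto

  obtain a where a: "a \<in> I" "a + int n \<in> I" "X (a + int n) \<le> x"
  proof -
    obtain S where S: "S \<subseteq> {j \<in> I. X j \<le> X k}" "finite S" "card S = m"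
      using left by blast
    hence "S \<noteq> {}"
      using mn by auto
    hence S': "Min S \<in> S" "Max S \<in> S" "Min S + int n \<le> Max S"
      using S mn by (auto intro: card_eq_imp_Min_add_le_Max)
    have "Min S \<in> I" "Max S \<in> I" "X (Max S) \<le> X k"
      using S(1) S'(1,2) by blast+
    moreover have "Min S + int n \<in> I"
      by (rule between[of "Min S" "Max S"]) (use calculation S' in auto)
    ultimately show ?thesis
      using mono[of "Min S + int n" "Max S"] S'(3) x by (intro that[of "Min S"]) auto
  qed
  obtain c where c: "c \<in> I" "c + int n \<in> I" "x < X c"
  proof -
    obtain S where S: "S \<subseteq> {j \<in> I. X j \<ge> X r}" "finite S" "card S = m"
      using right by blast
    hence "S \<noteq> {}"
      using mn by auto
    hence S': "Min S \<in> S" "Max S \<in> S" "Min S + int n \<le> Max S"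
      using S mn by (auto intro: card_eq_imp_Min_add_le_Max)
    have "Min S \<in> I" "Max S \<in> I" "X (Min S) \<ge> X r"
      using S(1) S'(1,2) by blast+
    moreover have "Min S + int n \<in> I"
      by (rule between[of "Min S" "Max S"]) (use calculation S' in auto)
    ultimately show ?thesis
      using x by (intro that[of "Min S"]) auto
  qed
  have ac: "a + int n < c"
    using mono[of c "a + int n"] a c by fastforce

  define g where "g j = hBspline_normalized h X m j x *
      (\<Prod>l = 1..m - 1. hexp h y - hexp h (X (j + int l)))" for j
  have telescope: "(\<Sum>j<N. g (b + int j)) =
      (if x < X (b + int N) then hpower h n y x else 0) - (if x < X b then hpower h n y x else 0)"
    if b: "b \<in> I" "b + int (N + n) \<in> I"
      and ends: "\<And>j. j \<in> {0, N} \<Longrightarrow> X (b + int (j + n)) \<le> x \<or> x < X (b + int j)" for b N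
  proof -
    have I: "b + int i \<in> I" if "i \<le> N + n" for i
      by (rule between[OF b]) (use that in auto)
    have gap: "0 < X (b + int (j + Suc n)) - X (b + int j) \<and>
        X (b + int (j + Suc n)) - X (b + int j) < 2 * pi * h / ln (1 + h)" if "j < N" for j
      using gaps[of "b + int j"] I[of j] I[of "j + Suc n"] that
      by (simp add: mn add_ac)
    have "g (b + int j) = (hexp h (X (b + int (j + Suc n))) - hexp h (X (b + int j))) *
        hdd h (\<lambda>y. htrunc_power h n y x) (\<lambda>i. X (b + int (j + i))) (Suc n) *
        (\<Prod>l = 1..n. hexp h y - hexp h (X (b + int (j + l))))" if "j < N" for j
      using gap[OF that]
      by (simp add: g_def hBspline_normalized_def hBspline_def mn add_ac)
    hence "(\<Sum>j<N. g (b + int j)) =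
        (\<Sum>j<N. (hexp h (X (b + int (j + Suc n))) - hexp h (X (b + int j))) *
        hdd h (\<lambda>y. htrunc_power h n y x) (\<lambda>i. X (b + int (j + i))) (Suc n) *
        (\<Prod>l = 1..n. hexp h y - hexp h (X (b + int (j + l)))))"
      by (intro sum.cong) auto
    also have "\<dots> = (if x < X (b + int N) then hpower h n y x else 0) -
        (if x < X (b + int 0) then hpower h n y x else 0)"
    proof (rule sum_hdd_htrunc[OF h])
      show "mono_on {..<N + Suc n} (\<lambda>i. X (b + int i))"
        by (intro mono_onI mono I) auto
    qed (use gap ends in auto)
    finally show ?thesis
      by simp
  qed

  \<comment> \<open>Left of index \<open>a\<close> and from index \<open>c\<close> on, all knots of a summand are on one side of \<open>x\<close>.\<close>
  have outside: "g j = 0" if j: "j \<in> I" "j + int m \<in> I" "j \<notin> {a..<c}" for j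
  proof -
    have jn: "j + int i \<in> I" if "i \<le> m" for i
      by (rule between[OF j(1,2)]) (use that in auto)
    consider "j < a" | "c \<le> j"
      using j(3) by fastforce
    hence "(\<forall>i\<le>m. X (j + int i) \<le> x) \<or> (\<forall>i\<le>m. x < X (j + int i))"
    proof cases
      case 1
      have "X (j + int i) \<le> x" if "i \<le> m" for i
        using mono[OF jn[OF that] a(2)] a(3) that 1 mn by auto
      thus ?thesis by blast
    next
      case 2
      have "x < X (j + int i)" if "i \<le> m" for i
        using mono[OF c(1) jn[OF that]] c(3) that 2 by auto
      thus ?thesis by blast
    qed
    thus "g j = 0"
    proof
      assume le: "\<forall>i\<le>m. X (j + int i) \<le> x"
      have "X (j + int (i + n)) \<le> x" if "i \<in> {0, 1}" for i
        using le[rule_format, of "i + n"] that mn by auto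
      hence "(\<Sum>i<1. g (j + int i)) =
          (if x < X (j + int 1) then hpower h n y x else 0) - (if x < X j then hpower h n y x else 0)"
        using j mn by (intro telescope) auto
      thus ?thesis
        using le[rule_format, of 0] le[rule_format, of 1] mn by auto
    next
      assume gt: "\<forall>i\<le>m. x < X (j + int i)"
      have "x < X (j + int i)" if "i \<in> {0, 1}" for i
        using gt that mn by auto
      hence "(\<Sum>i<1. g (j + int i)) =
          (if x < X (j + int 1) then hpower h n y x else 0) - (if x < X j then hpower h n y x else 0)"
        using j mn by (intro telescope) auto
      thus ?thesis
        using gt[rule_format, of 0] gt[rule_format, of 1] mn by auto
    qed
  qed

  have "(\<Sum>j\<in>{a..<c}. g j) = (\<Sum>j<nat (c - a). g (a + int j))"
    by (rule sum.reindex_bij_witness[of _ "\<lambda>j. a + int j" "\<lambda>j. nat (j - a)"]) auto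
  also have "\<dots> = hpower h n y x"
  proof -
    have "X a \<le> x"
      using mono[of a "a + int n"] a by auto
    moreover have "X (a + int (j + n)) \<le> x \<or> x < X (a + int j)" if "j \<in> {0, nat (c - a)}" for j
      using that a(3) c(3) ac by auto
    hence "(\<Sum>j<nat (c - a). g (a + int j)) =
        (if x < X (a + int (nat (c - a))) then hpower h n y x else 0) -
        (if x < X a then hpower h n y x else 0)"
      using a c ac by (intro telescope) auto
    ultimately show ?thesis
      using c ac by auto
  qed
  finally have "(g has_sum hpower h n y x) {a..<c}"
    using has_sum_finite[of "{a..<c}" g] by simp
  also have "?this \<longleftrightarrow> (g has_sum hpower h n y x) {j. j \<in> I \<and> j + int m \<in> I}"
  proof (rule has_sum_cong_neutral)
    fix j assume "j \<in> {a..<c} - {j. j \<in> I \<and> j + int m \<in> I}"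
    moreover have "j \<in> I" "j + int m \<in> I" if "j \<in> {a..<c}"
      by (rule between[of a "c + int n"]; use that a c mn in auto)+
    ultimately show "g j = 0" by blast
  qed (use outside in auto)
  finally show ?thesis
    unfolding g_def mn by simp
qed

end
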